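(* Let $-\infty<a<b<\infty$, let $\alpha>1$ be arbitrary and let $f\in C[a,b]$ be continuously Riemann-Liouville $\alpha$-differentiable. Then: (i) For every $0\le\beta<\alpha$ such that $\alpha-\beta\in\mathbb{N}$, the function $f$ is continuously Riemann-Liouville $\beta$-differentiable with $f_1:={}^{RL}D_a^{\beta}f\in C[a,b]$. The function $f_1$ is continuously Riemann-Liouville $(\alpha-\beta)$-differentiable, and $D^{\alpha-\beta}f_1={}^{RL}D_a^{\alpha}f$; thus $D^{\alpha-\beta}\,{}^{RL}D_a^{\beta}f={}^{RL}D_a^{\alpha}f$. (ii) For any $0\le\beta<\alpha-\lfloor\alpha\rfloor$, the function $f$ is continuously Riemann-Liouville $\beta$-differentiable with $f_1:={}^{RL}D_a^{\beta}f\in C[a,b]$. Moreover, $({}^{RL}D_a^{\beta}f)(a)=0$; the function $f_1$ is continuously Riemann-Liouville $\gamma$-differentiable for any $0<\gamma\le\alpha-\lfloor\alpha\rfloor-\beta$, and ${}^{RL}D_a^{\gamma}f_1={}^{RL}D_a^{\beta+\gamma}f$; thus ${}^{RL}D_a^{\gamma}\,{}^{RL}D_a^{\beta}f={}^{RL}D_a^{\beta+\gamma}f$.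
   Context: Let $[a,b]\subset\mathbb{R}$, $-\infty<a<b<\infty$. For $\alpha>0$ the Riemann-Liouville fractional integral operator is $J_a^\alpha f(x):=\frac{1}{\Gamma(\alpha)}\int_a^x (x-t)^{\alpha-1}f(t)\,dt$ for $a\le x\le b$; $J_a^0$ is the identity. $D^m$ denotes the ordinary derivative of integer order $m$. For $\alpha>0$ and $m:=\lceil\alpha\rceil$, the Riemann-Liouville fractional derivative of order $\alpha$ is ${}^{RL}D_a^{\alpha}f:=D^mJ_a^{m-\alpha}f$; ${}^{RL}D_a^0$ is the identity. A function $f$ is called continuously Riemann-Liouville $\alpha$-differentiable if $f\in C[a,b]$ and $D^mJ_a^{m-\alpha}f$ exists and belongs to $C[a,b]$ (for $\alpha=0$: if $f\in C[a,b]$). *)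

theory Defs
  imports "HOL-Analysis.Analysis"
begin

definition RL_integral :: "real \<Rightarrow> real \<Rightarrow> (real \<Rightarrow> real) \<Rightarrow> real \<Rightarrow> real" where
  "RL_integral a \<alpha> f x =
     (if \<alpha> = 0 then f x
      else (1 / Gamma \<alpha>) * (LINT t:{a..x}|lebesgue. (x - t) powr (\<alpha> - 1) * f t))"

text \<open>Functions on \<open>[a,b]\<close> are represented by total functions whose values outside \<open>[a,b]\<close>
  are irrelevant; accordingly derivatives are taken within \<open>{a..b}\<close>, hence are one-sided at the
  endpoints.  The value of \<open>nth_deriv_on S m g\<close> is meaningful only together with
  \<open>nth_differentiable_on S m g\<close>.\<close>

definition nth_deriv_on :: "real set \<Rightarrow> nat \<Rightarrow> (real \<Rightarrow> real) \<Rightarrow> real \<Rightarrow> real" where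
  "nth_deriv_on S m = (\<lambda>g x. vector_derivative g (at x within S)) ^^ m"

definition nth_differentiable_on :: "real set \<Rightarrow> nat \<Rightarrow> (real \<Rightarrow> real) \<Rightarrow> bool" where
  "nth_differentiable_on S m g \<longleftrightarrow> (\<forall>k<m. nth_deriv_on S k g differentiable_on S)"

definition RL_deriv :: "real \<Rightarrow> real \<Rightarrow> real \<Rightarrow> (real \<Rightarrow> real) \<Rightarrow> real \<Rightarrow> real" where
  "RL_deriv a b \<alpha> f =
     (let m = nat \<lceil>\<alpha>\<rceil> in nth_deriv_on {a..b} m (RL_integral a (real m - \<alpha>) f))"

definition cont_RL_differentiable :: "real \<Rightarrow> real \<Rightarrow> real \<Rightarrow> (real \<Rightarrow> real) \<Rightarrow> bool" where
  "cont_RL_differentiable a b \<alpha> f \<longleftrightarrow>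
     (let m = nat \<lceil>\<alpha>\<rceil> in
        continuous_on {a..b} f \<and>
        nth_differentiable_on {a..b} m (RL_integral a (real m - \<alpha>) f) \<and>
        continuous_on {a..b} (nth_deriv_on {a..b} m (RL_integral a (real m - \<alpha>) f)))"

text \<open>The order-zero conventions are instances of the general definitions.\<close>

lemma RL_deriv_0: "RL_deriv a b 0 f = f"
  by (auto simp: RL_deriv_def nth_deriv_on_def RL_integral_def)

lemma cont_RL_differentiable_0: "cont_RL_differentiable a b 0 f \<longleftrightarrow> continuous_on {a..b} f"
  by (auto simp: cont_RL_differentiable_def nth_differentiable_on_def nth_deriv_on_def
      RL_integral_def)

end

theory Submission
  imports Defs
begin

text \<open>On \<open>[a,b]\<close> the operator \<open>J\<^sup>p\<close> is convolution with the kernel \<open>u\<^sup>p\<^sup>-\<^sup>1 / \<Gamma>(p)\<close>, extended by zero to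
  \<open>u \<le> 0\<close>. By the Beta integral the kernels for \<open>p\<close> and \<open>q\<close> convolve to the one for \<open>p + q\<close>, so
  Fubini gives \<open>J\<^sup>p J\<^sup>q = J\<^sup>p\<^sup>+\<^sup>q\<close>. Part (i) only splits an iterated derivative: \<open>J\<close> is applied with the
  same exponent for \<open>\<alpha>\<close> and \<open>\<beta>\<close>. In particular \<open>f\<close> is \<open>\<theta>\<close>-differentiable for the fractional part
  \<open>\<theta>\<close> of \<open>\<alpha>\<close>, which forces \<open>f = J\<^sup>\<theta> h\<close> with \<open>h\<close> continuous; hence the derivative of order
  \<open>\<beta> \<le> \<theta>\<close> is \<open>J\<^sup>\<theta>\<^sup>-\<^sup>\<beta> h\<close>, and part (ii) reduces to the semigroup law.\<close>

section \<open>Power kernels and their convolution\<close>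

text \<open>With the zero extension, an integral over s < t < x becomes a convolution over the whole
  line. \<open>rl_kernel 1\<close> is the indicator of the positive reals, so
  \<open>C * rl_kernel 1 (s - a)\<close> expresses a bound and a support condition at once.\<close>

definition rl_kernel :: "real \<Rightarrow> real \<Rightarrow> real" where
  "rl_kernel p u = (if 0 < u then u powr (p - 1) / Gamma p else 0)"

text \<open>Dropping the value at a changes f on a null set only; freezing f at its value in b makes
  a the only possible discontinuity when f is continuous on [a,b].\<close>

definition cutoff :: "real \<Rightarrow> real \<Rightarrow> (real \<Rightarrow> real) \<Rightarrow> real \<Rightarrow> real" where
  "cutoff a b f t = (if a < t then f (min b t) else 0)"

lemma rl_kernel_measurable [measurable]: "rl_kernel p \<in> borel_measurable borel"
  unfolding rl_kernel_def[abs_def] by measurable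

lemma rl_kernel_nonneg: "p > 0 \<Longrightarrow> 0 \<le> rl_kernel p u"
  by (simp add: rl_kernel_def Gamma_real_pos less_imp_le)

text \<open>The substitution t = s + (x - s) u turns the integral into the Beta integral B(q,p) =
  \<Gamma>(q) \<Gamma>(p) / \<Gamma>(p + q), and the Gamma factors cancel to those of the kernel of
  order p + q.\<close>

lemma has_bochner_integral_rl_kernel:
  assumes p: "p > 0" and q: "q > 0"
  shows "has_bochner_integral lborel (\<lambda>t. rl_kernel p (x - t) * rl_kernel q (t - s))
           (rl_kernel (p + q) (x - s))"
proof (cases "s < x")
  case False
  then have "(\<lambda>t. rl_kernel p (x - t) * rl_kernel q (t - s)) = (\<lambda>t. 0)"
    by (auto simp: rl_kernel_def fun_eq_iff)
  moreover have "rl_kernel (p + q) (x - s) = 0" using False by (simp add: rl_kernel_def)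
  ultimately show ?thesis by (simp add: has_bochner_integral_zero)
next
  case True
  define c where "c = x - s"
  have c: "c > 0" using True by (simp add: c_def)
  have G: "Gamma p > 0" "Gamma q > 0" "Gamma (p + q) > 0"
    using p q by (auto intro: Gamma_real_pos)
  let ?B = "\<lambda>u. indicator {0..1} u *\<^sub>R (u powr (q - 1) * (1 - u) powr (p - 1))"
  have B: "has_bochner_integral lborel ?B (Beta q p)"
    using integrable_Beta[OF q p] set_borel_integral_eq_integral(2)[OF integrable_Beta[OF q p]]
      has_integral_Beta_real[OF q p]
    by (auto simp: has_bochner_integral_iff set_integrable_def set_lebesgue_integral_def
        integral_unique)
  \<comment> \<open>The two kernels contribute c^(p-1) and c^(q-1), whence the exponent p + q - 2;
    the Jacobian of the substitution is the division by |c| below.\<close>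
  have "has_bochner_integral lborel
      (\<lambda>u. (c powr (p + q - 2) / (Gamma p * Gamma q)) * ?B u)
      ((c powr (p + q - 2) / (Gamma p * Gamma q)) * Beta q p)"
    by (rule has_bochner_integral_mult_right) (use B in auto)
  moreover have "(c powr (p + q - 2) / (Gamma p * Gamma q)) * ?B u =
      rl_kernel p (x - (s + c * u)) * rl_kernel q ((s + c * u) - s)" for u
  proof -
    have 1: "x - (s + c * u) = c * (1 - u)" "(s + c * u) - s = c * u"
      by (auto simp: c_def algebra_simps)
    have 2: "c powr (p + q - 2) = c powr (p - 1) * c powr (q - 1)"
      by (simp flip: powr_add add: algebra_simps)
    show ?thesis
      unfolding 1 2 using c
      by (auto simp: rl_kernel_def indicator_def zero_less_mult_iff powr_mult)
  qed
  moreover have "(c powr (p + q - 2) / (Gamma p * Gamma q)) * Beta q p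
      = rl_kernel (p + q) (x - s) /\<^sub>R \<bar>c\<bar>"
  proof -
    have "c powr (p + q - 2) = c powr (p + q - 1) / c"
      using c powr_diff[of c "p + q - 1" 1] by (simp add: diff_diff_eq)
    moreover have "rl_kernel (p + q) (x - s) = c powr (p + q - 1) / Gamma (p + q)"
      using c by (simp add: rl_kernel_def c_def)
    ultimately show ?thesis
      using c G by (simp add: Beta_def add.commute divide_simps)
  qed
  ultimately show ?thesis
    using c by (subst lborel_has_bochner_integral_real_affine_iff[where t = s and c = c]) auto
qed

text \<open>The product is dominated by C times the product of the kernels of orders p and 1, which
  is integrable by the Beta integral.\<close>

lemma integrable_rl_kernel_mult:
  assumes p: "p > 0" and [measurable]: "h \<in> borel_measurable borel"
    and h: "\<And>s. \<bar>h s\<bar> \<le> C * rl_kernel 1 (s - a)"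
  shows "integrable lborel (\<lambda>s. rl_kernel p (x - s) * h s)"
proof (rule Bochner_Integration.integrable_bound)
  show "integrable lborel (\<lambda>s. C * (rl_kernel p (x - s) * rl_kernel 1 (s - a)))"
    using has_bochner_integral_rl_kernel[OF p, of 1 x a] by (auto simp: has_bochner_integral_iff)
  show "AE s in lborel. norm (rl_kernel p (x - s) * h s)
      \<le> norm (C * (rl_kernel p (x - s) * rl_kernel 1 (s - a)))"
  proof (rule AE_I2)
    fix s
    have "norm (rl_kernel p (x - s) * h s) = rl_kernel p (x - s) * \<bar>h s\<bar>"
      using rl_kernel_nonneg[OF p, of "x - s"] by (simp add: abs_mult)
    also have "\<dots> \<le> rl_kernel p (x - s) * (C * rl_kernel 1 (s - a))"
      by (intro mult_left_mono h rl_kernel_nonneg p)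
    also have "\<dots> = C * (rl_kernel p (x - s) * rl_kernel 1 (s - a))"
      by simp
    finally show "norm (rl_kernel p (x - s) * h s)
        \<le> norm (C * (rl_kernel p (x - s) * rl_kernel 1 (s - a)))"
      by simp
  qed
qed measurable

text \<open>Fubini's theorem. Integrating the absolute value in t first gives the kernel of order p
  + q times |h|, which is integrable; exchanging the integrals then leaves the Beta integral
  inside.\<close>

lemma rl_convolution_semigroup:
  assumes p: "p > 0" and q: "q > 0" and hm [measurable]: "h \<in> borel_measurable borel"
    and h: "\<And>s. \<bar>h s\<bar> \<le> C * rl_kernel 1 (s - a)"
  shows "(LINT t|lborel. rl_kernel p (x - t) * (LINT s|lborel. rl_kernel q (t - s) * h s))
       = (LINT s|lborel. rl_kernel (p + q) (x - s) * h s)"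
proof -
  let ?F = "\<lambda>s t. rl_kernel p (x - t) * rl_kernel q (t - s) * h s"
  have int: "integrable lborel (\<lambda>s. rl_kernel (p + q) (x - s) * \<bar>h s\<bar>)"
    by (rule integrable_rl_kernel_mult[where C = C and a = a]) (use p q h in auto)
  have "integrable (lborel \<Otimes>\<^sub>M lborel) (case_prod ?F)"
  proof (rule lborel_pair.Fubini_integrable)
    show "integrable lborel (\<lambda>s. LINT t|lborel. norm (case (s, t) of (s, t) \<Rightarrow> ?F s t))"
      using int rl_kernel_nonneg[OF p] rl_kernel_nonneg[OF q]
        has_bochner_integral_rl_kernel[OF p q, of x]
      by (simp add: abs_mult has_bochner_integral_iff)
    show "AE s in lborel. integrable lborel (\<lambda>t. case (s, t) of (s, t) \<Rightarrow> ?F s t)"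
      using has_bochner_integral_rl_kernel[OF p q, of x] by (simp add: has_bochner_integral_iff)
  qed measurable
  then have "(LINT t|lborel. LINT s|lborel. ?F s t) = (LINT s|lborel. LINT t|lborel. ?F s t)"
    by (rule lborel_pair.Fubini_integral)
  also have "(LINT s|lborel. LINT t|lborel. ?F s t)
      = (LINT s|lborel. rl_kernel (p + q) (x - s) * h s)"
    using has_bochner_integral_rl_kernel[OF p q, of x] by (simp add: has_bochner_integral_iff)
  finally show ?thesis
    by (simp add: mult.assoc)
qed

section \<open>Extension by cutoff and continuity of the convolution\<close>

lemma continuous_on_min_max:
  fixes f :: "real \<Rightarrow> real"
  assumes "a \<le> b" "continuous_on {a..b} f"
  shows "continuous_on UNIV (\<lambda>t. f (max a (min b t)))"
  by (rule continuous_on_compose2[OF assms(2)]) (use assms(1) in \<open>auto intro!: continuous_intros\<close>)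

lemma cutoff_eq: "a \<le> b \<Longrightarrow> cutoff a b f t = indicator {a<..} t * f (max a (min b t))"
  by (auto simp: cutoff_def max_def)

lemma cutoff_measurable:
  assumes "a \<le> b" "continuous_on {a..b} f"
  shows "cutoff a b f \<in> borel_measurable borel"
proof -
  have [measurable]: "(\<lambda>t. f (max a (min b t))) \<in> borel_measurable borel"
    using continuous_on_min_max[OF assms] by (rule borel_measurable_continuous_onI)
  show ?thesis
    unfolding cutoff_eq[OF assms(1), abs_def] by measurable
qed

lemma cutoff_bounded:
  assumes "continuous_on {a..b} f"
  obtains C where "C \<ge> 0" "\<And>t. a \<le> b \<Longrightarrow> \<bar>cutoff a b f t\<bar> \<le> C * rl_kernel 1 (t - a)"
proof -
  have "bounded (f ` {a..b})"
    using assms by (intro compact_imp_bounded compact_continuous_image) auto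
  then obtain C where C: "C > 0" "\<forall>x\<in>f ` {a..b}. norm x \<le> C"
    by (auto simp: bounded_pos)
  show thesis
  proof (rule that[of C])
    show "\<bar>cutoff a b f t\<bar> \<le> C * rl_kernel 1 (t - a)" if "a \<le> b" for t
      using C that by (auto simp: cutoff_def rl_kernel_def)
  qed (use C in simp)
qed

text \<open>After reflecting the convolution, dominated convergence applies: \<open>cutoff a b f\<close> is
  discontinuous only at \<open>a\<close>.\<close>

lemma continuous_on_rl_convolution:
  assumes p: "p > 0" and ab: "a \<le> b" and f: "continuous_on {a..b} f"
  shows "continuous_on {..b} (\<lambda>x. LINT t|lborel. rl_kernel p (x - t) * cutoff a b f t)"
proof -
  note [measurable] = cutoff_measurable[OF ab f]
  obtain C where C: "C \<ge> 0" "\<And>t. \<bar>cutoff a b f t\<bar> \<le> C * rl_kernel 1 (t - a)"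
    using cutoff_bounded[OF f] ab by metis
  have flip: "(LINT t|lborel. rl_kernel p (x - t) * cutoff a b f t)
      = (LINT u|lborel. rl_kernel p u * cutoff a b f (x - u))" for x
    by (subst lborel_integral_real_affine[where t = x and c = "-1"]) simp_all
  have cont: "isCont (cutoff a b f) t" if "t \<noteq> a" for t
  proof (cases "a < t")
    case True
    have "isCont (\<lambda>t. f (max a (min b t))) t"
      using continuous_on_min_max[OF ab f] by (simp add: continuous_on_eq_continuous_at)
    moreover have "eventually (\<lambda>u. cutoff a b f u = f (max a (min b u))) (nhds t)"
      using eventually_nhds_in_open[of "{a<..}" t] True
      by (auto elim!: eventually_mono simp: cutoff_eq[OF ab])
    ultimately show ?thesis using isCont_cong by metis
  next
    case False
    have "eventually (\<lambda>u. cutoff a b f u = 0) (nhds t)"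
      using eventually_nhds_in_open[of "{..<a}" t] False that
      by (auto elim!: eventually_mono simp: cutoff_eq[OF ab])
    then show ?thesis by (subst isCont_cong) auto
  qed
  show ?thesis
    unfolding flip continuous_on_sequentially comp_def
  proof (intro allI ballI impI)
    fix X x assume "x \<in> {..b}" and X: "(\<forall>n. X n \<in> {..b}) \<and> X \<longlonglongrightarrow> x"
    show "(\<lambda>n. LINT u|lborel. rl_kernel p u * cutoff a b f (X n - u))
        \<longlonglongrightarrow> (LINT u|lborel. rl_kernel p u * cutoff a b f (x - u))"
    proof (rule integral_dominated_convergence)
      \<comment> \<open>As X n <= b, \<open>cutoff a b f (X n - u)\<close> vanishes for u >= b - a.
        The majorant is therefore independent of n; it is written as a product of kernels so that
        the Beta integral gives its integrability.\<close>
      show "integrable lborel (\<lambda>u. C * (rl_kernel 1 ((b - a) - u) * rl_kernel p (u - 0)))"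
        using has_bochner_integral_rl_kernel[of 1 p "b - a" 0] p
        by (auto simp: has_bochner_integral_iff)
      show "AE u in lborel. norm (rl_kernel p u * cutoff a b f (X n - u))
          \<le> C * (rl_kernel 1 ((b - a) - u) * rl_kernel p (u - 0))" for n
      proof (rule AE_I2)
        fix u
        have "C * rl_kernel 1 (X n - u - a) \<le> C * rl_kernel 1 ((b - a) - u)"
          using X C(1) by (intro mult_left_mono) (auto simp: rl_kernel_def dest: spec[of _ n])
        then have "\<bar>cutoff a b f (X n - u)\<bar> \<le> C * rl_kernel 1 ((b - a) - u)"
          using C(2)[of "X n - u"] by linarith
        from mult_left_mono[OF this rl_kernel_nonneg[OF p, of u]]
        show "norm (rl_kernel p u * cutoff a b f (X n - u))
            \<le> C * (rl_kernel 1 ((b - a) - u) * rl_kernel p (u - 0))"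
          using rl_kernel_nonneg[OF p, of u] by (simp add: abs_mult mult_ac)
      qed
      \<comment> \<open>The exceptional point u = x - a is where the argument x - u meets the
        discontinuity a.\<close>
      show "AE u in lborel. (\<lambda>n. rl_kernel p u * cutoff a b f (X n - u))
          \<longlonglongrightarrow> rl_kernel p u * cutoff a b f (x - u)"
        using AE_lborel_singleton[of "x - a"]
      proof eventually_elim
        case (elim u)
        have "(\<lambda>n. X n - u) \<longlonglongrightarrow> x - u" using X by (intro tendsto_diff) auto
        then show ?case
          using elim by (intro tendsto_mult tendsto_const isCont_tendsto_compose[OF cont]) auto
      qed
    qed measurable
  qed
qed

section \<open>The fractional integral: continuity and semigroup law\<close>

lemma RL_integral_eq_convolution:
  assumes p: "p > 0" and f: "continuous_on {a..b} f" and x: "x \<in> {a..b}"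
  shows "RL_integral a p f x = (LINT t|lborel. rl_kernel p (x - t) * cutoff a b f t)"
proof -
  have ab: "a \<le> b" using x by auto
  note [measurable] = cutoff_measurable[OF ab f]
  have "(LINT t:{a..x}|lebesgue. (x - t) powr (p - 1) * f t)
      = (LINT t|lebesgue. Gamma p * (rl_kernel p (x - t) * cutoff a b f t))"
    unfolding set_lebesgue_integral_def
  proof (rule integral_cong_AE)
    \<comment> \<open>The integrands can differ only at t = a, which \<open>cutoff\<close> excludes;
      at t = x both vanish, because \<open>0 powr y\<close> is 0 for every y.\<close>
    have "eventually (\<lambda>t. t \<noteq> a) (ae_filter lebesgue)"
      by (rule AE_completion) (rule AE_lborel_singleton)
    then show "AE t in lebesgue. indicator {a..x} t *\<^sub>R ((x - t) powr (p - 1) * f t)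
        = Gamma p * (rl_kernel p (x - t) * cutoff a b f t)"
    proof eventually_elim
      case (elim t)
      then show ?case
        using x Gamma_real_pos[OF p]
        by (cases "t = x") (auto simp: rl_kernel_def cutoff_def indicator_def min_def)
    qed
    show "(\<lambda>t. Gamma p * (rl_kernel p (x - t) * cutoff a b f t)) \<in> borel_measurable lebesgue"
      by (rule measurable_completion) measurable
    \<comment> \<open>Outside [a,b] the function f is arbitrary, so the indicator is attached to f
      before measurability is claimed.\<close>
    have "continuous_on {a..x} f" using f x by (auto intro: continuous_on_subset)
    then have [measurable]: "(\<lambda>t. indicator {a..x} t * f t) \<in> borel_measurable borel"
      using borel_measurable_continuous_on_indicator[of "{a..x}" f] by simp
    have "(\<lambda>t. (x - t) powr (p - 1) * (indicator {a..x} t * f t)) \<in> borel_measurable lborel"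
      by measurable
    from measurable_completion[OF this]
    show "(\<lambda>t. indicator {a..x} t *\<^sub>R ((x - t) powr (p - 1) * f t)) \<in> borel_measurable lebesgue"
      by (simp add: mult_ac)
  qed
  also have "\<dots> = (LINT t|lborel. Gamma p * (rl_kernel p (x - t) * cutoff a b f t))"
    by (rule integral_completion) measurable
  finally show ?thesis
    using Gamma_real_pos[OF p] p by (simp add: RL_integral_def less_imp_neq[symmetric])
qed

lemma continuous_on_RL_integral:
  assumes p: "p \<ge> 0" and f: "continuous_on {a..b} f"
  shows "continuous_on {a..b} (RL_integral a p f)"
proof (cases "p = 0 \<or> \<not> a \<le> b")
  case True
  then show ?thesis using f by (auto simp: RL_integral_def cong: continuous_on_cong_simp)
next
  case False
  then have "continuous_on {a..b} (\<lambda>x. LINT t|lborel. rl_kernel p (x - t) * cutoff a b f t)"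
    using p by (intro continuous_on_subset[OF continuous_on_rl_convolution[OF _ _ f]]) auto
  then show ?thesis
    using RL_integral_eq_convolution[OF _ f] p False by (simp cong: continuous_on_cong_simp)
qed

lemma RL_integral_cong:
  assumes "\<And>t. t \<in> {a..x} \<Longrightarrow> f t = g t" "a \<le> x"
  shows "RL_integral a p f x = RL_integral a p g x"
proof -
  have "(LINT t:{a..x}|lebesgue. (x - t) powr (p - 1) * f t)
      = (LINT t:{a..x}|lebesgue. (x - t) powr (p - 1) * g t)"
    using assms(1) by (intro set_lebesgue_integral_cong) auto
  then show ?thesis using assms by (simp add: RL_integral_def)
qed

text \<open>Only t = a survives the indicator, and there \<open>(a - t) powr (p - 1)\<close> is 0 by
  convention, so the integrand is identically zero.\<close>

lemma RL_integral_at_base: "p \<noteq> 0 \<Longrightarrow> RL_integral a p f a = 0"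
proof -
  have "(LINT t:{a..a}|lebesgue. (a - t) powr (p - 1) * f t) = (LINT t::real|lebesgue. 0)"
    unfolding set_lebesgue_integral_def
    by (rule Bochner_Integration.integral_cong) (auto simp: indicator_def)
  then show "p \<noteq> 0 \<Longrightarrow> ?thesis" by (simp add: RL_integral_def)
qed

text \<open>For positive orders both integrals are rewritten as convolutions; order zero is the
  identity.\<close>

lemma RL_integral_semigroup:
  assumes p: "p \<ge> 0" and q: "q \<ge> 0" and f: "continuous_on {a..b} f" and x: "x \<in> {a..b}"
  shows "RL_integral a p (RL_integral a q f) x = RL_integral a (p + q) f x"
proof (cases "p = 0 \<or> q = 0")
  case True
  moreover have "RL_integral a 0 f = f" for f by (simp add: RL_integral_def fun_eq_iff)
  ultimately show ?thesis by auto
next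
  case False
  with p q have pq: "p > 0" "q > 0" "p + q > 0" by auto
  have ab: "a \<le> b" using x by auto
  obtain C where C: "\<And>t. \<bar>cutoff a b f t\<bar> \<le> C * rl_kernel 1 (t - a)"
    using cutoff_bounded[OF f] ab by metis
  have "RL_integral a p (RL_integral a q f) x
      = (LINT t|lborel. rl_kernel p (x - t) * cutoff a b (RL_integral a q f) t)"
    using pq continuous_on_RL_integral[OF q f] x by (intro RL_integral_eq_convolution)
  also have "\<dots> = (LINT t|lborel. rl_kernel p (x - t) *
      (LINT s|lborel. rl_kernel q (t - s) * cutoff a b f s))"
  proof (rule Bochner_Integration.integral_cong)
    fix t
    \<comment> \<open>For t >= x the outer kernel vanishes, and for t <= a both inner functions do;
      the convolution formula is needed only for t in between.\<close>
    consider "t \<ge> x" | "t \<le> a" | "a < t" "t < x" by linarith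
    then show "rl_kernel p (x - t) * cutoff a b (RL_integral a q f) t
        = rl_kernel p (x - t) * (LINT s|lborel. rl_kernel q (t - s) * cutoff a b f s)"
    proof cases
      case 1
      then show ?thesis by (simp add: rl_kernel_def)
    next
      case 2
      then have "(\<lambda>s. rl_kernel q (t - s) * cutoff a b f s) = (\<lambda>s. 0)"
        by (auto simp: rl_kernel_def cutoff_def)
      with 2 show ?thesis by (simp add: cutoff_def)
    next
      case 3
      then show ?thesis
        using x RL_integral_eq_convolution[OF pq(2) f, of t] by (simp add: cutoff_def min_def)
    qed
  qed simp
  also have "\<dots> = (LINT s|lborel. rl_kernel (p + q) (x - s) * cutoff a b f s)"
    by (rule rl_convolution_semigroup[OF pq(1,2) cutoff_measurable[OF ab f] C])
  also have "\<dots> = RL_integral a (p + q) f x"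
    using RL_integral_eq_convolution[OF pq(3) f x] by simp
  finally show ?thesis .
qed

section \<open>Order one and the fundamental theorem of calculus\<close>

lemma RL_integral_1:
  assumes f: "continuous_on {a..b} f" and x: "x \<in> {a..b}"
  shows "RL_integral a 1 f x = integral {a..x} f"
proof -
  have f': "continuous_on {a..x} f" using f x by (auto intro: continuous_on_subset)
  have "RL_integral a 1 f x = (LINT t:{a..x}|lebesgue. (x - t) powr 0 * f t)"
    by (simp add: RL_integral_def)
  also have "\<dots> = (LINT t:{a..x}|lebesgue. f t)"
    unfolding set_lebesgue_integral_def
  proof (rule integral_cong_AE)
    \<comment> \<open>At t = x the factor is \<open>0 powr 0\<close>, which is 0 and not 1.\<close>
    have "eventually (\<lambda>t. t \<noteq> x) (ae_filter lebesgue)"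
      by (rule AE_completion) (rule AE_lborel_singleton)
    then show "AE t in lebesgue. indicator {a..x} t *\<^sub>R ((x - t) powr 0 * f t)
        = indicator {a..x} t *\<^sub>R f t"
      by eventually_elim auto
    have [measurable]: "(\<lambda>t. indicator {a..x} t * f t) \<in> borel_measurable borel"
      using borel_measurable_continuous_on_indicator[OF _ f'] by simp
    show "(\<lambda>t. indicator {a..x} t *\<^sub>R f t) \<in> borel_measurable lebesgue"
      by (rule measurable_completion) simp
    have "(\<lambda>t. (x - t) powr 0 * (indicator {a..x} t * f t)) \<in> borel_measurable lborel"
      by measurable
    from measurable_completion[OF this]
    show "(\<lambda>t. indicator {a..x} t *\<^sub>R ((x - t) powr 0 * f t)) \<in> borel_measurable lebesgue"
      by (simp add: mult_ac)
  qed
  also have "\<dots> = integral {a..x} f"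
    using f' by (intro set_lebesgue_integral_eq_integral absolutely_integrable_continuous_real)
  finally show ?thesis .
qed

text \<open>The separate \<open>F\<close> lets one differentiate functions that are identified with
  a first-order integral only on [a,b], such as J^(1-\<beta>) f.\<close>

lemma RL_integral_1_has_vector_derivative:
  assumes f: "continuous_on {a..b} f" and x: "x \<in> {a..b}"
    and F: "\<And>t. t \<in> {a..b} \<Longrightarrow> F t = RL_integral a 1 f t"
  shows "(F has_vector_derivative f x) (at x within {a..b})"
  using integral_has_vector_derivative[OF f x] x
  by (rule has_vector_derivative_transform[rotated 2]) (simp_all add: F RL_integral_1[OF f])

section \<open>Fractional derivatives of order at most one\<close>

lemma RL_differentiable_le_1_simps:
  assumes "0 < \<alpha>" "\<alpha> \<le> 1"
  shows "cont_RL_differentiable a b \<alpha> f \<longleftrightarrow> continuous_on {a..b} f \<and>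
    RL_integral a (1 - \<alpha>) f differentiable_on {a..b} \<and> continuous_on {a..b} (RL_deriv a b \<alpha> f)"
    and "RL_deriv a b \<alpha> f x = vector_derivative (RL_integral a (1 - \<alpha>) f) (at x within {a..b})"
proof -
  have "\<lceil>\<alpha>\<rceil> = 1" using assms by linarith
  then show "cont_RL_differentiable a b \<alpha> f \<longleftrightarrow> continuous_on {a..b} f \<and>
    RL_integral a (1 - \<alpha>) f differentiable_on {a..b} \<and> continuous_on {a..b} (RL_deriv a b \<alpha> f)"
    and "RL_deriv a b \<alpha> f x = vector_derivative (RL_integral a (1 - \<alpha>) f) (at x within {a..b})"
    by (auto simp: cont_RL_differentiable_def RL_deriv_def nth_differentiable_on_def
        nth_deriv_on_def)
qed

text \<open>By the semigroup law, J^(1-\<beta>) J^\<mu> h = J^1 J^(\<mu>-\<beta>) h, and one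
  differentiation removes J^1. This serves both f and its derivative of order \<beta> in part
  (ii).\<close>

lemma RL_deriv_of_RL_integral:
  assumes ab: "a < b" and h: "continuous_on {a..b} h"
    and f: "\<And>t. t \<in> {a..b} \<Longrightarrow> f t = RL_integral a \<mu> h t"
    and \<beta>: "0 \<le> \<beta>" "\<beta> \<le> \<mu>" "\<beta> \<le> 1"
  shows "cont_RL_differentiable a b \<beta> f"
    and "\<And>x. x \<in> {a..b} \<Longrightarrow> RL_deriv a b \<beta> f x = RL_integral a (\<mu> - \<beta>) h x"
proof -
  let ?g = "RL_integral a (\<mu> - \<beta>) h"
  have cf: "continuous_on {a..b} f"
    using continuous_on_RL_integral[OF _ h, of \<mu>] f \<beta> by (simp cong: continuous_on_cong_simp)
  have cg: "continuous_on {a..b} ?g"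
    using \<beta> h by (intro continuous_on_RL_integral) auto
  have "cont_RL_differentiable a b \<beta> f \<and> (\<forall>x\<in>{a..b}. RL_deriv a b \<beta> f x = ?g x)"
  proof (cases "\<beta> = 0")
    case True
    then show ?thesis using cf f by (simp add: cont_RL_differentiable_0 RL_deriv_0)
  next
    case False
    with \<beta> have pos: "0 < \<beta>" by simp
    have "RL_integral a (1 - \<beta>) f t = RL_integral a 1 ?g t" if t: "t \<in> {a..b}" for t
    proof -
      have "RL_integral a (1 - \<beta>) f t = RL_integral a (1 - \<beta>) (RL_integral a \<mu> h) t"
        using f t by (intro RL_integral_cong) auto
      also have "\<dots> = RL_integral a (1 - \<beta> + \<mu>) h t"
        using \<beta> h t by (intro RL_integral_semigroup) auto
      also have "\<dots> = RL_integral a (1 + (\<mu> - \<beta>)) h t" by (simp add: algebra_simps)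
      also have "\<dots> = RL_integral a 1 ?g t"
        using \<beta> h t by (intro RL_integral_semigroup[symmetric]) auto
      finally show ?thesis .
    qed
    then have d: "(RL_integral a (1 - \<beta>) f has_vector_derivative ?g x) (at x within {a..b})"
      if "x \<in> {a..b}" for x
      using that cg by (intro RL_integral_1_has_vector_derivative)
    \<comment> \<open>Since a < b, the derivative within [a,b] is unique, also at the
      endpoints.\<close>
    then have eq: "\<forall>x\<in>{a..b}. RL_deriv a b \<beta> f x = ?g x"
      using ab pos \<beta> by (simp add: RL_differentiable_le_1_simps
          vector_derivative_within_closed_interval)
    moreover have "RL_integral a (1 - \<beta>) f differentiable_on {a..b}"
      unfolding differentiable_on_def using d differentiableI_vector by blast
    ultimately show ?thesis
      using cf cg pos \<beta> by (simp add: RL_differentiable_le_1_simps cong: continuous_on_cong_simp)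
  qed
  then show "cont_RL_differentiable a b \<beta> f"
    and "\<And>x. x \<in> {a..b} \<Longrightarrow> RL_deriv a b \<beta> f x = RL_integral a (\<mu> - \<beta>) h x"
    by auto
qed

text \<open>For \<open>\<theta> < 1\<close> the integral \<open>J\<^sup>1\<^sup>-\<^sup>\<theta> f\<close> vanishes at \<open>a\<close>, so it equals \<open>J\<^sup>1 h = J\<^sup>1\<^sup>-\<^sup>\<theta> J\<^sup>\<theta> h\<close>
  with \<open>h\<close> its derivative; applying \<open>J\<^sup>\<theta>\<close> and differentiating cancels the outer operators.\<close>

lemma RL_integral_RL_deriv:
  assumes ab: "a < b" and \<theta>: "0 < \<theta>" "\<theta> < 1" and f: "cont_RL_differentiable a b \<theta> f"
    and x: "x \<in> {a..b}"
  shows "f x = RL_integral a \<theta> (RL_deriv a b \<theta> f) x"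
proof -
  define h where "h = RL_deriv a b \<theta> f"
  let ?g = "RL_integral a (1 - \<theta>) f"
  have cf: "continuous_on {a..b} f" and dg: "?g differentiable_on {a..b}"
    and ch: "continuous_on {a..b} h"
    using f \<theta> by (simp_all add: RL_differentiable_le_1_simps h_def)
  have g: "?g t = RL_integral a 1 h t" if t: "t \<in> {a..b}" for t
  proof -
    have "(?g has_vector_derivative h s) (at s within {a..b})" if "s \<in> {a..b}" for s
    proof -
      have "?g differentiable (at s within {a..b})"
        using dg that by (auto simp: differentiable_on_def)
      then show ?thesis
        using \<theta> by (simp add: h_def RL_differentiable_le_1_simps vector_derivative_works)
    qed
    then have "(h has_integral (?g t - ?g a)) {a..t}"
      using t by (intro fundamental_theorem_of_calculus
          has_vector_derivative_within_subset[where S = "{a..b}" and T = "{a..t}"]) auto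
    then show ?thesis
      using RL_integral_1[OF ch t] \<theta> by (simp add: integral_unique RL_integral_at_base)
  qed
  have J: "RL_integral a 1 f t = RL_integral a 1 (RL_integral a \<theta> h) t" if t: "t \<in> {a..b}" for t
  proof -
    have "RL_integral a 1 f t = RL_integral a \<theta> ?g t"
      using RL_integral_semigroup[of \<theta> "1 - \<theta>", OF _ _ cf t] \<theta> by simp
    also have "\<dots> = RL_integral a \<theta> (RL_integral a 1 h) t"
      using g t by (intro RL_integral_cong) auto
    also have "\<dots> = RL_integral a 1 (RL_integral a \<theta> h) t"
      using RL_integral_semigroup[OF _ _ ch t, of \<theta> 1] RL_integral_semigroup[OF _ _ ch t, of 1 \<theta>] \<theta>
      by (simp add: add.commute)
    finally show ?thesis .
  qed
  \<comment> \<open>J^1 f is differentiated in two ways, and uniqueness of the derivative gives f =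
    J^\<theta> h pointwise, endpoints included.\<close>
  have "(RL_integral a 1 f has_vector_derivative f x) (at x within {a..b})"
    using cf x by (rule RL_integral_1_has_vector_derivative) simp
  moreover have "(RL_integral a 1 f has_vector_derivative RL_integral a \<theta> h x) (at x within {a..b})"
    using continuous_on_RL_integral[OF _ ch, of \<theta>] x \<theta> J
    by (intro RL_integral_1_has_vector_derivative) auto
  ultimately show ?thesis
    unfolding h_def using vector_derivative_within_closed_interval[OF ab x] by metis
qed

section \<open>Splitting off derivatives of integer order\<close>

lemma nth_deriv_on_add:
  "nth_deriv_on S (m + n) g = nth_deriv_on S m (nth_deriv_on S n g)"
  by (simp add: nth_deriv_on_def funpow_add)

lemma nth_differentiable_on_add:
  "nth_differentiable_on S (m + n) g \<longleftrightarrow>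
     nth_differentiable_on S n g \<and> nth_differentiable_on S m (nth_deriv_on S n g)"
proof -
  have "(\<forall>k<m + n. P k) \<longleftrightarrow> (\<forall>k<n. P k) \<and> (\<forall>k<m. P (k + n))" for P
  proof (intro iffI conjI allI impI)
    fix k assume "(\<forall>k<n. P k) \<and> (\<forall>k<m. P (k + n))" "k < m + n"
    then show "P k" by (cases "k < n") (auto dest: spec[of _ "k - n"])
  qed auto
  then show ?thesis by (simp add: nth_differentiable_on_def nth_deriv_on_add)
qed

lemma cont_RL_differentiable_nat_iff:
  "cont_RL_differentiable a b (real n) f \<longleftrightarrow> continuous_on {a..b} f \<and>
     nth_differentiable_on {a..b} n f \<and> continuous_on {a..b} (nth_deriv_on {a..b} n f)"
proof -
  have "RL_integral a 0 f = f" by (simp add: RL_integral_def fun_eq_iff)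
  then show ?thesis by (simp add: cont_RL_differentiable_def)
qed

text \<open>Adding n to \<beta> raises the ceiling m by exactly n, so the exponent m - \<beta> of
  the inner integral is unchanged and only the outer derivative D^(n+m) has to be split.\<close>

lemma RL_deriv_split_nat:
  assumes "0 \<le> \<beta>"
  shows "RL_deriv a b (\<beta> + real n) f = nth_deriv_on {a..b} n (RL_deriv a b \<beta> f)"
    and "0 < n \<Longrightarrow> cont_RL_differentiable a b (\<beta> + real n) f \<Longrightarrow> cont_RL_differentiable a b \<beta> f"
    and "0 < n \<Longrightarrow> cont_RL_differentiable a b (\<beta> + real n) f \<Longrightarrow>
      cont_RL_differentiable a b (real n) (RL_deriv a b \<beta> f)"
proof -
  define m where "m = nat \<lceil>\<beta>\<rceil>"
  have ceil: "nat \<lceil>\<beta> + real n\<rceil> = n + m"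
  proof -
    have "\<lceil>\<beta> + real n\<rceil> = \<lceil>\<beta>\<rceil> + int n" by linarith
    then show ?thesis using assms by (simp add: m_def nat_add_distrib)
  qed
  let ?g = "RL_integral a (real m - \<beta>) f"
  have sub: "real (n + m) - (\<beta> + real n) = real m - \<beta>" by simp
  have D: "RL_deriv a b \<beta> f = nth_deriv_on {a..b} m ?g"
    by (simp add: RL_deriv_def m_def Let_def)
  show "RL_deriv a b (\<beta> + real n) f = nth_deriv_on {a..b} n (RL_deriv a b \<beta> f)"
    unfolding RL_deriv_def[of _ _ "\<beta> + real n"] D Let_def ceil sub by (rule nth_deriv_on_add)
  assume n: "0 < n" and "cont_RL_differentiable a b (\<beta> + real n) f"
  then have *: "continuous_on {a..b} f" "nth_differentiable_on {a..b} m ?g"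
      "nth_differentiable_on {a..b} n (nth_deriv_on {a..b} m ?g)"
      "continuous_on {a..b} (nth_deriv_on {a..b} n (nth_deriv_on {a..b} m ?g))"
    unfolding cont_RL_differentiable_def Let_def ceil sub
    by (auto simp: nth_differentiable_on_add nth_deriv_on_add)
  \<comment> \<open>As n > 0, the index 0 is covered: the derivative of order \<beta> is itself
    differentiable, hence continuous.\<close>
  have "nth_deriv_on {a..b} 0 (nth_deriv_on {a..b} m ?g) differentiable_on {a..b}"
    using *(3) n unfolding nth_differentiable_on_def by blast
  then have c: "continuous_on {a..b} (nth_deriv_on {a..b} m ?g)"
    by (intro differentiable_imp_continuous_on) (simp add: nth_deriv_on_def)
  show "cont_RL_differentiable a b \<beta> f"
    using * c by (simp add: cont_RL_differentiable_def Let_def flip: m_def)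
  show "cont_RL_differentiable a b (real n) (RL_deriv a b \<beta> f)"
    using * c by (simp add: cont_RL_differentiable_nat_iff D)
qed

theorem theorem4:
  fixes a b \<alpha> :: real and f :: "real \<Rightarrow> real"
  assumes "a < b" and "\<alpha> > 1"
    and "continuous_on {a..b} f"
    and "cont_RL_differentiable a b \<alpha> f"
  shows
    "(\<forall>\<beta> n. 0 \<le> \<beta> \<and> \<beta> < \<alpha> \<and> \<alpha> - \<beta> = real n \<longrightarrow>
        cont_RL_differentiable a b \<beta> f \<and>
        continuous_on {a..b} (RL_deriv a b \<beta> f) \<and>
        cont_RL_differentiable a b (\<alpha> - \<beta>) (RL_deriv a b \<beta> f) \<and>
        nth_differentiable_on {a..b} n (RL_deriv a b \<beta> f) \<and>
        (\<forall>x\<in>{a..b}. nth_deriv_on {a..b} n (RL_deriv a b \<beta> f) x = RL_deriv a b \<alpha> f x))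
     \<and>
     (\<forall>\<beta>. 0 \<le> \<beta> \<and> \<beta> < \<alpha> - of_int \<lfloor>\<alpha>\<rfloor> \<longrightarrow>
        cont_RL_differentiable a b \<beta> f \<and>
        continuous_on {a..b} (RL_deriv a b \<beta> f) \<and>
        RL_deriv a b \<beta> f a = 0 \<and>
        (\<forall>\<gamma>. 0 < \<gamma> \<and> \<gamma> \<le> \<alpha> - of_int \<lfloor>\<alpha>\<rfloor> - \<beta> \<longrightarrow>
           cont_RL_differentiable a b \<gamma> (RL_deriv a b \<beta> f) \<and>
           cont_RL_differentiable a b (\<beta> + \<gamma>) f \<and>
           (\<forall>x\<in>{a..b}. RL_deriv a b \<gamma> (RL_deriv a b \<beta> f) x = RL_deriv a b (\<beta> + \<gamma>) f x)))"
proof (intro conjI[of "\<forall>x. _ x" "\<forall>x. _ x"] allI impI)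
  \<comment> \<open>Part (i): \<beta> < \<alpha> forces n > 0, and the splitting lemma applies
    directly.\<close>
  fix \<beta> n assume A: "0 \<le> \<beta> \<and> \<beta> < \<alpha> \<and> \<alpha> - \<beta> = real n"
  then have eq: "\<alpha> = \<beta> + real n" "\<alpha> - \<beta> = real n" and n: "0 < n" and \<beta>: "0 \<le> \<beta>"
    by (auto intro: gr0I)
  have 1: "cont_RL_differentiable a b \<beta> f" "cont_RL_differentiable a b (real n) (RL_deriv a b \<beta> f)"
    using RL_deriv_split_nat(2,3)[OF \<beta> n] assms(4) eq(1) by auto
  show "cont_RL_differentiable a b \<beta> f \<and>
        continuous_on {a..b} (RL_deriv a b \<beta> f) \<and>
        cont_RL_differentiable a b (\<alpha> - \<beta>) (RL_deriv a b \<beta> f) \<and>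
        nth_differentiable_on {a..b} n (RL_deriv a b \<beta> f) \<and>
        (\<forall>x\<in>{a..b}. nth_deriv_on {a..b} n (RL_deriv a b \<beta> f) x = RL_deriv a b \<alpha> f x)"
    unfolding eq(2) using 1 RL_deriv_split_nat(1)[OF \<beta>, of a b n f] eq(1)
    by (simp add: cont_RL_differentiable_nat_iff)
next
  \<comment> \<open>Part (ii): the assumption on \<beta> makes the fractional part \<theta> of
    \<alpha> positive, and \<alpha> > 1 makes its integer part positive, so the splitting lemma
    gives differentiability of order \<theta>.\<close>
  fix \<beta> assume A: "0 \<le> \<beta> \<and> \<beta> < \<alpha> - of_int \<lfloor>\<alpha>\<rfloor>"
  define \<theta> where "\<theta> = \<alpha> - of_int \<lfloor>\<alpha>\<rfloor>"
  define n where "n = nat \<lfloor>\<alpha>\<rfloor>"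
  define h where "h = RL_deriv a b \<theta> f"
  have \<beta>: "0 \<le> \<beta>" "\<beta> < \<theta>" using A by (auto simp: \<theta>_def)
  have \<theta>: "0 < \<theta>" "\<theta> < 1" using \<beta> by (auto simp: \<theta>_def) linarith
  have n: "0 < n" "\<alpha> = \<theta> + real n"
    using assms(2) by (auto simp: n_def \<theta>_def)
  have d\<theta>: "cont_RL_differentiable a b \<theta> f"
    using RL_deriv_split_nat(2)[of \<theta> n] \<theta> n assms(4) by auto
  then have h: "continuous_on {a..b} h"
    using \<theta> by (simp add: h_def RL_differentiable_le_1_simps)
  have f: "f t = RL_integral a \<theta> h t" if "t \<in> {a..b}" for t
    unfolding h_def using assms(1) \<theta> d\<theta> that by (rule RL_integral_RL_deriv)
  note f_deriv = RL_deriv_of_RL_integral[OF assms(1) h f]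
  define f1 where "f1 = RL_deriv a b \<beta> f"
  have f1: "f1 t = RL_integral a (\<theta> - \<beta>) h t" if "t \<in> {a..b}" for t
    unfolding f1_def using f_deriv(2)[of \<beta>] \<beta> \<theta> that by auto
  note f1_deriv = RL_deriv_of_RL_integral[OF assms(1) h f1]
  have c1: "cont_RL_differentiable a b \<beta> f" using f_deriv(1) \<beta> \<theta> by auto
  have c2: "continuous_on {a..b} f1"
    using continuous_on_RL_integral[OF _ h, of "\<theta> - \<beta>"] f1 \<beta> by (simp cong: continuous_on_cong_simp)
  \<comment> \<open>\<open>f1\<close> is an integral of order \<theta> - \<beta> > 0, and such
    integrals vanish at a.\<close>
  have f1a: "f1 a = 0" using f1[of a] assms(1) \<beta> by (simp add: RL_integral_at_base)
  have "cont_RL_differentiable a b \<gamma> f1 \<and> cont_RL_differentiable a b (\<beta> + \<gamma>) f \<and>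
      (\<forall>x\<in>{a..b}. RL_deriv a b \<gamma> f1 x = RL_deriv a b (\<beta> + \<gamma>) f x)"
    if "0 < \<gamma>" "\<gamma> \<le> \<theta> - \<beta>" for \<gamma>
    \<comment> \<open>Both derivatives equal J^(\<theta>-\<beta>-\<gamma>) h, whose order is
      nonnegative by the bound on \<gamma>.\<close>
    using f_deriv[of "\<beta> + \<gamma>"] f1_deriv[of \<gamma>] that \<beta> \<theta> by (simp add: algebra_simps)
  with c1 c2 f1a show "cont_RL_differentiable a b \<beta> f \<and>
        continuous_on {a..b} (RL_deriv a b \<beta> f) \<and>
        RL_deriv a b \<beta> f a = 0 \<and>
        (\<forall>\<gamma>. 0 < \<gamma> \<and> \<gamma> \<le> \<alpha> - of_int \<lfloor>\<alpha>\<rfloor> - \<beta> \<longrightarrow>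
           cont_RL_differentiable a b \<gamma> (RL_deriv a b \<beta> f) \<and>
           cont_RL_differentiable a b (\<beta> + \<gamma>) f \<and>
           (\<forall>x\<in>{a..b}. RL_deriv a b \<gamma> (RL_deriv a b \<beta> f) x = RL_deriv a b (\<beta> + \<gamma>) f x))"
    unfolding f1_def \<theta>_def by blast
qed

end
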